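(* Let $(\mathcal{R},W)$ be any Strip Packing instance and let the rectangles be ordered by the $\mathcal{FQW}$-ordering (with arbitrary tie-breaking). Then the packing produced by the Bottom-Left algorithm on this ordering has height $h_{\mathrm{BL}}\le \frac{13}{6}\,h_{\mathrm{OPT}}$.
   Context: Strip Packing: an instance $(\mathcal{R},W)$ consists of a vertical strip $[0,W]\times[0,\infty)$ with $W>0$ and a finite set $\mathcal{R}$ of $n$ axis-parallel closed rectangles; rectangle $r$ has width $w_r\in(0,W]$ and height $h_r>0$. A packing assigns to each $r$ a position $(x_r,y_r)$ (its lower-left corner); it is feasible if $x_r\ge 0$, $x_r+w_r\le W$, $y_r\ge 0$ for all $r$ and the open rectangles $(x_r,x_r+w_r)\times(y_r,y_r+h_r)$ are pairwise disjoint; rotations are not allowed. The height of a packing is $\max_r (y_r+h_r)$, and $h_{\mathrm{OPT}}$ is the minimum height of a feasible packing. Bottom-Left (BL) algorithm: given an ordering $r_1,\dots,r_n$ of $\mathcal{R}$, place $r_1$ at $(0,0)$; for $i=2,\dots,n$, given the positions of $r_1,\dots,r_{i-1}$, choose a position $(x_{r_i},y_{r_i})$ such that $r_1,\dots,r_i$ form a feasible packing and $(y_{r_i},x_{r_i})$ is lexicographically minimal among all such choices. $h_{\mathrm{BL}}$ denotes the height of the resulting packing. $\mathcal{FQW}$-partition: go through the rectangles of $\mathcal{R}$ in order of non-increasing height (ties broken arbitrarily), and add rectangle $r$ to the set $\mathcal{F}$ (initially empty) if and only if $w_r+\sum_{f\in\mathcal{F}}w_f\le W$. Let $\mathcal{W}=\{r\in\mathcal{R}\setminus\mathcal{F}: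 w_r>W/2\}$ and $\mathcal{Q}=\mathcal{R}\setminus(\mathcal{F}\cup\mathcal{W})$. The $\mathcal{FQW}$-ordering lists first the rectangles of $\mathcal{F}$ by non-increasing height, then those of $\mathcal{Q}$ by non-increasing width, then those of $\mathcal{W}$ in any order; ties are broken arbitrarily. *)

theory Defs
  imports "HOL-Analysis.Analysis"
begin

text \<open>
  Rectangles are abstract identifiers of type \<open>'r\<close> with a width and a height function, so that
  distinct rectangles may have equal dimensions. A packing maps each rectangle to the
  coordinates \<open>(x, y)\<close> of its lower-left corner; its values outside the rectangle set in question
  are irrelevant.
\<close>

definition strip_instance :: "'r set \<Rightarrow> ('r \<Rightarrow> real) \<Rightarrow> ('r \<Rightarrow> real) \<Rightarrow> real \<Rightarrow> bool" where
  "strip_instance R w h W \<longleftrightarrow>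
     W > 0 \<and> finite R \<and> (\<forall>r\<in>R. 0 < w r \<and> w r \<le> W \<and> 0 < h r)"

definition open_rect ::
  "('r \<Rightarrow> real) \<Rightarrow> ('r \<Rightarrow> real) \<Rightarrow> ('r \<Rightarrow> real \<times> real) \<Rightarrow> 'r \<Rightarrow> (real \<times> real) set" where
  "open_rect w h p r =
     {fst (p r) <..< fst (p r) + w r} \<times> {snd (p r) <..< snd (p r) + h r}"

definition feasible ::
  "'r set \<Rightarrow> ('r \<Rightarrow> real) \<Rightarrow> ('r \<Rightarrow> real) \<Rightarrow> real \<Rightarrow> ('r \<Rightarrow> real \<times> real) \<Rightarrow> bool" where
  "feasible R w h W p \<longleftrightarrow>
     (\<forall>r\<in>R. 0 \<le> fst (p r) \<and> fst (p r) + w r \<le> W \<and> 0 \<le> snd (p r)) \<and>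
     pairwise (\<lambda>r s. open_rect w h p r \<inter> open_rect w h p s = {}) R"

text \<open>The height of the packing of no rectangles is 0 by convention.\<close>

definition packing_height :: "'r set \<Rightarrow> ('r \<Rightarrow> real) \<Rightarrow> ('r \<Rightarrow> real \<times> real) \<Rightarrow> real" where
  "packing_height R h p = (if R = {} then 0 else Max ((\<lambda>r. snd (p r) + h r) ` R))"

text \<open>
  The minimum height of a feasible packing is written as an infimum; the lemma
  \<open>opt_height_attained\<close> below shows that it is indeed a minimum.
\<close>

definition opt_height :: "'r set \<Rightarrow> ('r \<Rightarrow> real) \<Rightarrow> ('r \<Rightarrow> real) \<Rightarrow> real \<Rightarrow> real" where
  "opt_height R w h W = Inf {packing_height R h p | p. feasible R w h W p}"

text \<open>Comparison of positions \<open>(x, y)\<close> by the lexicographic order of \<open>(y, x)\<close>.\<close>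

definition bl_le :: "real \<times> real \<Rightarrow> real \<times> real \<Rightarrow> bool" where
  "bl_le q q' \<longleftrightarrow> snd q < snd q' \<or> (snd q = snd q' \<and> fst q \<le> fst q')"

text \<open>
  \<open>bottom_left w h W rs p\<close>: the positions that \<open>p\<close> assigns to the members of \<open>rs\<close> are those chosen
  by the Bottom-Left algorithm on the ordering \<open>rs\<close>. Existence and uniqueness of the result are
  shown in \<open>bottom_left_exists\<close> and \<open>bottom_left_unique\<close>.
\<close>

definition bottom_left ::
  "('r \<Rightarrow> real) \<Rightarrow> ('r \<Rightarrow> real) \<Rightarrow> real \<Rightarrow> 'r list \<Rightarrow> ('r \<Rightarrow> real \<times> real) \<Rightarrow> bool" where
  "bottom_left w h W rs p \<longleftrightarrow>
     (rs \<noteq> [] \<longrightarrow> p (rs ! 0) = (0, 0)) \<and>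
     (\<forall>i. 1 \<le> i \<and> i < length rs \<longrightarrow>
        feasible (set (take (Suc i) rs)) w h W p \<and>
        (\<forall>q. feasible (set (take (Suc i) rs)) w h W (p(rs ! i := q)) \<longrightarrow> bl_le (p (rs ! i)) q))"

definition ordering_of :: "'r set \<Rightarrow> 'r list \<Rightarrow> bool" where
  "ordering_of A xs \<longleftrightarrow> distinct xs \<and> set xs = A"

fun greedy_F :: "('r \<Rightarrow> real) \<Rightarrow> real \<Rightarrow> 'r list \<Rightarrow> 'r set \<Rightarrow> 'r set" where
  "greedy_F w W [] F = F"
| "greedy_F w W (r # rs) F =
     greedy_F w W rs (if w r + (\<Sum>f\<in>F. w f) \<le> W then insert r F else F)"

text \<open>The list \<open>xs\<close> resolves the ties in the order in which the rectangles are scanned.\<close>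

definition FQW_partition ::
  "'r set \<Rightarrow> ('r \<Rightarrow> real) \<Rightarrow> ('r \<Rightarrow> real) \<Rightarrow> real \<Rightarrow> 'r set \<Rightarrow> 'r set \<Rightarrow> 'r set \<Rightarrow> bool" where
  "FQW_partition R w h W \<F> \<Q> \<W> \<longleftrightarrow>
     (\<exists>xs. ordering_of R xs \<and> sorted_wrt (\<lambda>r s. h r \<ge> h s) xs \<and> \<F> = greedy_F w W xs {}) \<and>
     \<W> = {r \<in> R - \<F>. w r > W / 2} \<and>
     \<Q> = R - (\<F> \<union> \<W>)"

definition FQW_ordering ::
  "'r set \<Rightarrow> ('r \<Rightarrow> real) \<Rightarrow> ('r \<Rightarrow> real) \<Rightarrow> real \<Rightarrow> 'r list \<Rightarrow> bool" where
  "FQW_ordering R w h W rs \<longleftrightarrow>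
     (\<exists>\<F> \<Q> \<W> fs qs ws. FQW_partition R w h W \<F> \<Q> \<W> \<and> rs = fs @ qs @ ws \<and>
        ordering_of \<F> fs \<and> sorted_wrt (\<lambda>r s. h r \<ge> h s) fs \<and>
        ordering_of \<Q> qs \<and> sorted_wrt (\<lambda>r s. w r \<ge> w s) qs \<and>
        ordering_of \<W> ws)"


lemma open_rect_disjoint_iff:
  assumes "0 < w r" "0 < h r" "0 < w s" "0 < h s"
  shows "open_rect w h p r \<inter> open_rect w h p s = {} \<longleftrightarrow>
     fst (p r) + w r \<le> fst (p s) \<or> fst (p s) + w s \<le> fst (p r) \<or>
     snd (p r) + h r \<le> snd (p s) \<or> snd (p s) + h s \<le> snd (p r)" (is "?L \<longleftrightarrow> ?R")
proof
  assume ?L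
  show ?R
  proof (rule ccontr)
    assume n: "\<not> ?R"
    obtain x where "max (fst (p r)) (fst (p s)) < x" "x < min (fst (p r) + w r) (fst (p s) + w s)"
      using dense[of "max (fst (p r)) (fst (p s))" "min (fst (p r) + w r) (fst (p s) + w s)"]
        n assms by auto
    moreover obtain y where "max (snd (p r)) (snd (p s)) < y" "y < min (snd (p r) + h r) (snd (p s) + h s)"
      using dense[of "max (snd (p r)) (snd (p s))" "min (snd (p r) + h r) (snd (p s) + h s)"]
        n assms by auto
    ultimately have "(x, y) \<in> open_rect w h p r \<inter> open_rect w h p s"
      by (auto simp: open_rect_def)
    with \<open>?L\<close> show False by auto
  qed
qed (auto simp: open_rect_def)

lemma feasible_iff:
  assumes "\<forall>r\<in>R. 0 < w r \<and> 0 < h r"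
  shows "feasible R w h W p \<longleftrightarrow>
     (\<forall>r\<in>R. 0 \<le> fst (p r) \<and> fst (p r) + w r \<le> W \<and> 0 \<le> snd (p r)) \<and>
     (\<forall>r\<in>R. \<forall>s\<in>R. r \<noteq> s \<longrightarrow>
        fst (p r) + w r \<le> fst (p s) \<or> fst (p s) + w s \<le> fst (p r) \<or>
        snd (p r) + h r \<le> snd (p s) \<or> snd (p s) + h s \<le> snd (p r))"
proof -
  have "open_rect w h p r \<inter> open_rect w h p s = {} \<longleftrightarrow>
     fst (p r) + w r \<le> fst (p s) \<or> fst (p s) + w s \<le> fst (p r) \<or>
     snd (p r) + h r \<le> snd (p s) \<or> snd (p s) + h s \<le> snd (p r)" if "r \<in> R" "s \<in> R" for r s
    using assms that by (intro open_rect_disjoint_iff) auto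
  then show ?thesis
    unfolding feasible_def pairwise_def by (simp cong: ball_cong)
qed

lemma feasible_cong:
  assumes "\<And>r. r \<in> R \<Longrightarrow> p r = q r"
  shows "feasible R w h W p \<longleftrightarrow> feasible R w h W q"
  using assms by (simp add: feasible_def pairwise_def open_rect_def)

lemma feasible_mono: "feasible R w h W p \<Longrightarrow> S \<subseteq> R \<Longrightarrow> feasible S w h W p"
  by (auto simp: feasible_def pairwise_def subset_iff)

lemma closed_feasible:
  fixes P :: "'a::topological_space \<Rightarrow> 'r \<Rightarrow> real \<times> real"
  assumes R: "finite R" "\<forall>r\<in>R. 0 < w r \<and> 0 < h r"
    and cont: "\<And>r. continuous_on UNIV (\<lambda>a. P a r)"
  shows "closed {a. feasible R w h W (P a)}"
  unfolding feasible_iff[of R w h, OF R(2)] Ball_def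
  by (intro closed_Collect_conj closed_Collect_all closed_Collect_imp closed_Collect_disj
      closed_Collect_le open_Collect_const continuous_intros cont)

lemma feasible_extend:
  assumes R: "finite R" "\<forall>s\<in>insert r R. 0 < w s \<and> w s \<le> W \<and> 0 < h s"
    and p: "feasible R w h W p" and r: "r \<notin> R"
  shows "\<exists>q. feasible (insert r R) w h W (p(r := q))"
proof -
  define H where "H = Max (insert 0 ((\<lambda>s. snd (p s) + h s) ` R))"
  have H: "0 \<le> H" "\<forall>s\<in>R. snd (p s) + h s \<le> H"
    using R by (auto simp: H_def)
  have pos: "\<forall>s\<in>insert r R. 0 < w s \<and> 0 < h s" "\<forall>s\<in>R. 0 < w s \<and> 0 < h s" using R by auto
  have "feasible (insert r R) w h W (p(r := (0, H)))"
    using p H R r unfolding feasible_iff[of _ w h, OF pos(1)] feasible_iff[of _ w h, OF pos(2)]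
    by auto
  then show ?thesis ..
qed

lemma feasible_exists:
  assumes "finite R" "\<forall>s\<in>R. 0 < w s \<and> w s \<le> W \<and> 0 < h s"
  shows "\<exists>p. feasible R w h W p"
  using assms
proof (induction R rule: finite_induct)
  case empty
  show ?case by (simp add: feasible_def)
next
  case (insert r R)
  then obtain p where "feasible R w h W p" by auto
  with insert show ?case using feasible_extend[of R r w W h p] by auto
qed

lemma feasible_height_bounds:
  assumes "finite R" "r \<in> R"
  shows "snd (p r) + h r \<le> packing_height R h p"
  using assms by (auto simp: packing_height_def)

lemma compact_box:
  fixes S :: "'r \<Rightarrow> (real \<times> real) set"
  assumes "\<And>r. compact (S r)"
  shows "compact {p. \<forall>r. p r \<in> S r}"
proof -
  have "compact (PiE UNIV S)"
    using assms compactin_PiE[of "\<lambda>_. euclidean" UNIV S] euclidean_product_topology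
    by (metis compactin_euclidean_iff)
  then show ?thesis by (simp add: PiE_UNIV_domain Pi_def)
qed

theorem opt_height_attained:
  assumes "strip_instance R w h W"
  shows "\<exists>p. feasible R w h W p \<and> packing_height R h p = opt_height R w h W \<and>
           (\<forall>q. feasible R w h W q \<longrightarrow> packing_height R h p \<le> packing_height R h q)"
proof (cases "R = {}")
  case True
  then show ?thesis by (auto simp: feasible_def packing_height_def opt_height_def)
next
  case False
  have R: "finite R" "\<forall>s\<in>R. 0 < w s \<and> w s \<le> W \<and> 0 < h s" "\<forall>s\<in>R. 0 < w s \<and> 0 < h s"
    using assms by (auto simp: strip_instance_def)
  obtain p0 where p0: "feasible R w h W p0" using feasible_exists[OF R(1,2)] by auto
  define H where "H = packing_height R h p0"
  define S :: "'a \<Rightarrow> (real \<times> real) set" where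
    "S r = (if r \<in> R then cbox (0, 0) (W, H) else {(0, 0)})" for r
  define K where "K = {p. \<forall>r. p r \<in> S r} \<inter> {p. feasible R w h W p}"
  define rst where "rst p = (\<lambda>r. if r \<in> R then p r else (0, 0))" for p :: "'a \<Rightarrow> real \<times> real"
  have rst: "feasible R w h W (rst p) \<longleftrightarrow> feasible R w h W p"
       "packing_height R h (rst p) = packing_height R h p" for p
    by (auto simp: rst_def packing_height_def intro!: feasible_cong arg_cong[where f=Max] image_cong)
  have inK: "rst p \<in> K" if "feasible R w h W p" "packing_height R h p \<le> H" for p
  proof -
    have "p r \<in> cbox (0, 0) (W, H)" if "r \<in> R" for r
    proof -
      have "0 \<le> fst (p r)" "fst (p r) \<le> W" "0 \<le> snd (p r)"
        using \<open>feasible R w h W p\<close> that R(3) unfolding feasible_def by force+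
      moreover have "snd (p r) \<le> H"
        using feasible_height_bounds[OF R(1) that, of p h] R(3) that \<open>packing_height R h p \<le> H\<close> by force
      ultimately show ?thesis
        by (cases "p r") (auto simp: cbox_Pair_eq)
    qed
    then show ?thesis using that rst by (auto simp: K_def S_def rst_def)
  qed
  have coord: "continuous_on UNIV (\<lambda>p::'a \<Rightarrow> real \<times> real. p r)" for r
    by (rule continuous_on_product_coordinates)
  have "compact K"
    unfolding K_def
    by (intro compact_Int_closed compact_box closed_feasible R coord) (auto simp: S_def)
  moreover have "K \<noteq> {}" using inK[OF p0] by (auto simp: H_def)
  moreover have "continuous_on K (packing_height R h)"
  proof -
    have "continuous_on UNIV (\<lambda>p::'a \<Rightarrow> real \<times> real. Max ((\<lambda>r. snd (p r) + h r) ` A))"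
      if "finite A" "A \<noteq> {}" for A
      using that
    proof (induction A rule: finite_ne_induct)
      case (singleton x)
      show ?case by (simp, intro continuous_intros coord)
    next
      case (insert x F)
      then have "(\<lambda>p::'a \<Rightarrow> real \<times> real. Max ((\<lambda>r. snd (p r) + h r) ` insert x F)) =
        (\<lambda>p. max (snd (p x) + h x) (Max ((\<lambda>r. snd (p r) + h r) ` F)))" by auto
      then show ?case using insert by (auto intro!: continuous_intros coord)
    qed
    from this[OF R(1) False] show ?thesis
      using False by (simp add: packing_height_def[abs_def] continuous_on_subset[OF _ subset_UNIV])
  qed
  ultimately obtain p where p: "p \<in> K" "\<And>q. q \<in> K \<Longrightarrow> packing_height R h p \<le> packing_height R h q"
    using continuous_attains_inf[of K "packing_height R h"] by blast
  have min: "packing_height R h p \<le> packing_height R h q" if "feasible R w h W q" for q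
  proof (cases "packing_height R h q \<le> H")
    case True
    with p(2)[OF inK[OF that]] rst show ?thesis by simp
  next
    case False
    with p(2)[OF inK[OF p0]] rst show ?thesis by (simp add: H_def)
  qed
  have "feasible R w h W p" using p by (simp add: K_def)
  then have "opt_height R w h W = packing_height R h p"
    unfolding opt_height_def by (intro cInf_eq_minimum) (auto simp: min)
  with \<open>feasible R w h W p\<close> min show ?thesis by auto
qed

lemma bl_position_exists:
  assumes R: "finite R" "\<forall>s\<in>insert r R. 0 < w s \<and> w s \<le> W \<and> 0 < h s"
    and p: "feasible R w h W p" and r: "r \<notin> R"
  shows "\<exists>q. feasible (insert r R) w h W (p(r := q)) \<and>
     (\<forall>q'. feasible (insert r R) w h W (p(r := q')) \<longrightarrow> bl_le q q')"
proof -
  let ?f = "\<lambda>q. feasible (insert r R) w h W (p(r := q))"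
  obtain q0 where q0: "?f q0" using feasible_extend[OF assms] by auto
  define K where "K = cbox (0, 0) (W, snd q0) \<inter> {q. ?f q}"
  have cont: "continuous_on UNIV (\<lambda>q. (p(r := q)) s)" for s
    by (cases "s = r") (auto intro: continuous_intros)
  have closed: "closed {q. ?f q}"
    using R by (intro closed_feasible cont) auto
  have inK: "q \<in> K" if "?f q" "snd q \<le> snd q0" for q
    using that R(2) by (cases q) (auto simp: K_def cbox_Pair_eq feasible_def)
  have K: "compact K" unfolding K_def by (intro compact_Int_closed compact_cbox closed)
  moreover have "K \<noteq> {}" using inK[OF q0] by auto
  ultimately obtain a where a: "a \<in> K" "\<And>q. q \<in> K \<Longrightarrow> snd a \<le> snd q"
    using continuous_attains_inf[of K snd] continuous_on_snd[OF continuous_on_id] by blast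
  have "compact (K \<inter> {q. snd q = snd a})"
    by (intro compact_Int_closed K closed_Collect_eq continuous_intros)
  moreover have "K \<inter> {q. snd q = snd a} \<noteq> {}" using a by auto
  ultimately obtain b where b: "b \<in> K" "snd b = snd a"
      "\<And>q. q \<in> K \<Longrightarrow> snd q = snd a \<Longrightarrow> fst b \<le> fst q"
    using continuous_attains_inf[of "K \<inter> {q. snd q = snd a}" fst] continuous_on_fst[OF continuous_on_id]
    by blast
  have "bl_le b q" if "?f q" for q
  proof (cases "snd q \<le> snd q0")
    case True
    from inK[OF that True] a b show ?thesis unfolding bl_le_def by (metis less_le)
  next
    case False
    with a(2)[OF inK[OF q0]] b(2) show ?thesis by (auto simp: bl_le_def)
  qed
  moreover have "?f b" using b by (simp add: K_def)
  ultimately show ?thesis by blast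
qed

lemma bottom_left_feasible:
  assumes "\<forall>r\<in>set rs. w r \<le> W" "bottom_left w h W rs p"
  shows "feasible (set rs) w h W p"
proof (cases "length rs \<le> 1")
  case True
  then have "rs = [] \<or> (\<exists>r. rs = [r])" by (cases rs) auto
  then show ?thesis using assms by (auto simp: feasible_def bottom_left_def)
next
  case False
  then have "1 \<le> length rs - 1 \<and> length rs - 1 < length rs" by auto
  then have "feasible (set (take (Suc (length rs - 1)) rs)) w h W p"
    using assms(2) unfolding bottom_left_def by blast
  then show ?thesis using False by simp
qed

theorem bottom_left_exists:
  assumes "strip_instance R w h W" "ordering_of R rs"
  shows "\<exists>p. bottom_left w h W rs p"
proof -
  have "\<forall>s\<in>set rs. 0 < w s \<and> w s \<le> W \<and> 0 < h s" "distinct rs"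
    using assms by (auto simp: strip_instance_def ordering_of_def)
  then show ?thesis
  proof (induction rs rule: rev_induct)
    case Nil
    show ?case by (simp add: bottom_left_def)
  next
    case (snoc r rs)
    then obtain p where p: "bottom_left w h W rs p" by auto
    have r: "r \<notin> set rs" using snoc by auto
    show ?case
    proof (cases "rs = []")
      case True
      then show ?thesis by (auto simp: bottom_left_def intro!: exI[of _ "\<lambda>_. (0, 0)"])
    next
      case False
      have "feasible (set rs) w h W p"
        using bottom_left_feasible p snoc.prems by fastforce
      then obtain q where q: "feasible (insert r (set rs)) w h W (p(r := q))"
        "\<And>q'. feasible (insert r (set rs)) w h W (p(r := q')) \<Longrightarrow> bl_le q q'"
        using bl_position_exists[of "set rs" r w W h p] snoc.prems r by auto
      have "bottom_left w h W (rs @ [r]) (p(r := q))"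
        unfolding bottom_left_def
      proof (intro conjI impI allI; (elim conjE)?)
        show "(p(r := q)) ((rs @ [r]) ! 0) = (0, 0)"
          using p False r by (auto simp: bottom_left_def nth_append)
      next
        fix i assume i: "1 \<le> i" "i < length (rs @ [r])"
        show "feasible (set (take (Suc i) (rs @ [r]))) w h W (p(r := q))"
        proof (rule feasible_mono[OF q(1)])
          show "set (take (Suc i) (rs @ [r])) \<subseteq> insert r (set rs)"
            using set_take_subset[of "Suc i" "rs @ [r]"] by simp
        qed
        fix q' assume f: "feasible (set (take (Suc i) (rs @ [r]))) w h W ((p(r := q))((rs @ [r]) ! i := q'))"
        show "bl_le ((p(r := q)) ((rs @ [r]) ! i)) q'"
        proof (cases "i = length rs")
          case True
          then show ?thesis using f q(2) by simp
        next
          case neq: False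
          then have i': "i < length rs" using i by auto
          then have ne: "rs ! i \<noteq> r" using r nth_mem by metis
          have "r \<notin> set (take (Suc i) rs)" using r set_take_subset by fastforce
          then have "feasible (set (take (Suc i) rs)) w h W (p(rs ! i := q'))"
            using f i' by (subst feasible_cong[where q = "(p(r := q))(rs ! i := q')"])
              (auto simp: nth_append)
          then have "bl_le (p (rs ! i)) q'" using p i(1) i' unfolding bottom_left_def by blast
          then show ?thesis using i' ne by (simp add: nth_append)
        qed
      qed
      then show ?thesis by blast
    qed
  qed
qed

theorem bottom_left_unique:
  assumes "bottom_left w h W rs p" "bottom_left w h W rs p'" "r \<in> set rs"
  shows "p r = p' r"
proof -
  have "p (rs ! i) = p' (rs ! i)" if "i < length rs" for i
    using that
  proof (induction i rule: less_induct)
    case (less i)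
    show ?case
    proof (cases "i = 0")
      case True
      then show ?thesis using assms less by (auto simp: bottom_left_def)
    next
      case False
      have eq: "p s = p' s" if "s \<in> set (take (Suc i) rs)" "s \<noteq> rs ! i" for s
      proof -
        from that(1) obtain j where "j < Suc i" "j < length rs" "s = rs ! j"
          by (auto simp: in_set_conv_nth)
        with that(2) less show ?thesis by (metis less_SucE)
      qed
      have "feasible (set (take (Suc i) rs)) w h W (p(rs ! i := p' (rs ! i)))"
           "feasible (set (take (Suc i) rs)) w h W (p'(rs ! i := p (rs ! i)))"
      proof -
        have f: "feasible (set (take (Suc i) rs)) w h W p" "feasible (set (take (Suc i) rs)) w h W p'"
          using assms(1,2) False less.prems unfolding bottom_left_def by auto
        show "feasible (set (take (Suc i) rs)) w h W (p(rs ! i := p' (rs ! i)))"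
          using f(2) by (rule feasible_cong[THEN iffD1, rotated]) (use eq in auto)
        show "feasible (set (take (Suc i) rs)) w h W (p'(rs ! i := p (rs ! i)))"
          using f(1) by (rule feasible_cong[THEN iffD1, rotated]) (use eq in auto)
      qed
      then have "bl_le (p (rs ! i)) (p' (rs ! i))" "bl_le (p' (rs ! i)) (p (rs ! i))"
        using assms(1,2) False less.prems unfolding bottom_left_def
        by (metis less_one not_less)+
      then show ?thesis by (auto simp: bl_le_def prod_eq_iff)
    qed
  qed
  with assms(3) show ?thesis by (metis in_set_conv_nth)
qed

end

theory Submission
  imports Defs
begin

text \<open>
  Let \<open>a(t)\<close> be the total width of the rectangles of \<open>\<F>\<close> higher than \<open>t\<close>; all of \<open>\<F>\<close> stands on the
  floor, ordered by height. A horizontal line at height \<open>t\<close> below a rectangle \<open>q\<close> of \<open>\<Q>\<close> can be covered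
  to less than one half only if there is a gap between the part of length \<open>a(t)\<close> and the first
  rectangle \<open>B\<close> of \<open>\<Q>\<close> on it. Then \<open>B\<close> is stopped on its left by a rectangle of \<open>\<F>\<close> whose top lies
  above the bottom of \<open>B\<close>, so the gap ends at most at \<open>a(t - k)\<close>, where \<open>k\<close> is the maximum height
  in \<open>\<Q>\<close>. Hence the deficit of the line is at most \<open>g(t - k) - g(t)\<close> for \<open>g = min a (W / 3)\<close>, and
  by telescoping the deficits integrate to at most \<open>k W / 3\<close>. Here \<open>2 k \<le> h\<^sub>O\<^sub>P\<^sub>T\<close>, because a
  rejected rectangle and the members of \<open>\<F>\<close> at least as high do not fit side by side. Since moreover
  \<open>a(t) > W - w q\<close> for \<open>t < h q\<close>, twice the area of \<open>\<F> \<union> \<Q>\<close> is at least \<open>W\<close> times the top of \<open>q\<close>,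
  up to the term \<open>W h\<^sub>O\<^sub>P\<^sub>T / 6\<close>. A wide rectangle of \<open>\<W>\<close> raises the packing by at most its height, and
  twice its area exceeds \<open>W\<close> times that height.
\<close>

section \<open>Lengths of intervals and integrals of step functions\<close>

lemma interval_cover_le_sum:
  fixes l u :: "'a \<Rightarrow> real"
  assumes "finite X" "\<And>s. s \<in> X \<Longrightarrow> l s \<le> u s" "{a..b} \<subseteq> (\<Union>s\<in>X. {l s..u s})"
  shows "b - a \<le> (\<Sum>s\<in>X. u s - l s)"
proof (cases "a \<le> b")
  case True
  have "b - a = measure lborel {a..b}" using True by simp
  also have "\<dots> \<le> measure lborel (\<Union>s\<in>X. {l s..u s})"
    using assms by (intro measure_mono_fmeasurable fmeasurable.finite_UN)
      (auto simp: fmeasurable_def)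
  also have "\<dots> \<le> (\<Sum>s\<in>X. measure lborel {l s..u s})"
    using assms by (intro measure_UNION_le) auto
  also have "\<dots> = (\<Sum>s\<in>X. u s - l s)" using assms by (intro sum.cong) auto
  finally show ?thesis .
next
  case False
  have "0 \<le> (\<Sum>s\<in>X. u s - l s)" using assms by (intro sum_nonneg) auto
  with False show ?thesis by simp
qed

text \<open>Serves in both directions: horizontally for the rectangles met by a line, vertically for
  rectangles too wide to lie side by side.\<close>

lemma disjoint_intervals_sum_le:
  fixes x d :: "'a \<Rightarrow> real"
  assumes "finite X" "\<And>s. s \<in> X \<Longrightarrow> 0 \<le> d s"
    and "\<And>s. s \<in> X \<Longrightarrow> 0 \<le> x s \<and> x s + d s \<le> L"
    and "\<And>r s. r \<in> X \<Longrightarrow> s \<in> X \<Longrightarrow> r \<noteq> s \<Longrightarrow> x r + d r \<le> x s \<or> x s + d s \<le> x r"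
    and "0 \<le> L"
  shows "sum d X \<le> L"
proof -
  have sub: "(\<Union>s\<in>X. {x s<..<x s + d s}) \<subseteq> {0..L}" using assms(3) by force
  have "sum d X = (\<Sum>s\<in>X. measure lborel {x s<..<x s + d s})"
    using assms(2) by (intro sum.cong) auto
  also have "\<dots> = measure lborel (\<Union>s\<in>X. {x s<..<x s + d s})"
  proof (intro measure_UNION'[symmetric])
    show "pairwise (\<lambda>r s. disjnt {x r<..<x r + d r} {x s<..<x s + d s}) X"
      unfolding pairwise_def disjnt_iff using assms(4) by (auto; smt (verit))
  qed (use assms in \<open>auto simp: fmeasurable_def\<close>)
  also have "\<dots> \<le> measure lborel {0..L}"
    using assms(5) by (intro measure_mono_fmeasurable sub)
      (auto simp: fmeasurable_def intro!: borel_open)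
  finally show ?thesis using assms(5) by simp
qed

lemma integral_step_sum:
  fixes d w y :: "'a \<Rightarrow> real"
  assumes "\<And>s. s \<in> A \<Longrightarrow> 0 \<le> d s"
  shows "integrable lborel (\<lambda>t. \<Sum>s\<in>A. w s * indicator {y s..<y s + d s} t)"
    and "integral\<^sup>L lborel (\<lambda>t. \<Sum>s\<in>A. w s * indicator {y s..<y s + d s} t) = (\<Sum>s\<in>A. w s * d s)"
proof -
  have *: "integrable lborel (\<lambda>t. w s * indicator {y s..<y s + d s} t)" if "s \<in> A" for s
    using assms[OF that] by (intro integrable_mult_right integrable_real_indicator) auto
  then show "integrable lborel (\<lambda>t. \<Sum>s\<in>A. w s * indicator {y s..<y s + d s} t)"
    by (rule Bochner_Integration.integrable_sum)
  show "integral\<^sup>L lborel (\<lambda>t. \<Sum>s\<in>A. w s * indicator {y s..<y s + d s} t) = (\<Sum>s\<in>A. w s * d s)"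
    using assms by (subst Bochner_Integration.integral_sum[OF *]) (auto intro!: sum.cong)
qed

section \<open>The greedy choice of \<open>\<F>\<close>\<close>

lemma greedy_F_subset: "F \<subseteq> greedy_F w W xs F" "greedy_F w W xs F \<subseteq> F \<union> set xs"
  by (induction xs arbitrary: F) (auto split: if_splits, fastforce+)

lemma greedy_F_sum_le:
  assumes "finite F" "sum w F \<le> W"
  shows "sum w (greedy_F w W xs F) \<le> W"
  using assms by (induction xs arbitrary: F) (auto simp: sum.insert_if)

text \<open>When \<open>r\<close> is scanned, everything accepted so far is at least as high and
  exceeds \<open>W\<close> together with \<open>r\<close>; later acceptances only add to the sum.
  The height condition on \<open>F\<close> carries this through the induction.\<close>

lemma greedy_F_rejected:
  assumes "finite F" "sorted_wrt (\<lambda>r s. h r \<ge> h s) xs"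
    and "\<forall>f\<in>F. \<forall>r\<in>set xs. h f \<ge> h r" "\<forall>r\<in>F \<union> set xs. 0 \<le> w r"
    and "r \<in> set xs" "r \<notin> greedy_F w W xs F"
  shows "W < w r + (\<Sum>f | f \<in> greedy_F w W xs F \<and> h r \<le> h f. w f)"
  using assms
proof (induction xs arbitrary: F)
  case (Cons r' xs)
  show ?case
  \<comment> \<open>If \<open>r = r'\<close>, the head was rejected, so the second conjunct holds as
    well; the other branch is therefore just \<open>r \<noteq> r'\<close>.\<close>
  proof (cases "r = r' \<and> r \<notin> greedy_F w W xs F")
    case True
    let ?G = "greedy_F w W (r' # xs) F"
    have "r \<notin> ?G" using Cons.prems by blast
    then have rej: "W < w r + sum w F"
      using True greedy_F_subset(1)[of "insert r F" w W xs] by (auto split: if_splits)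
    have "finite ?G"
      using finite_subset[OF greedy_F_subset(2)] Cons.prems(1) by (metis finite_Un finite_set)
    moreover have "F \<subseteq> {f \<in> ?G. h r \<le> h f}"
      using greedy_F_subset(1)[of F w W "r' # xs"] Cons.prems(3) True by auto
    moreover have "\<forall>f\<in>?G. 0 \<le> w f"
      using greedy_F_subset(2)[of w W "r' # xs" F] Cons.prems(4) by blast
    ultimately have "sum w F \<le> (\<Sum>f | f \<in> ?G \<and> h r \<le> h f. w f)"
      by (intro sum_mono2) auto
    with rej show ?thesis by linarith
  next
    case False
    let ?F = "if w r' + sum w F \<le> W then insert r' F else F"
    have "r \<noteq> r' \<or> \<not> (w r' + sum w F > W)"
      using False Cons.prems(6) by auto
    then have "r \<in> set xs"
      using Cons.prems(5,6) greedy_F_subset(1)[of "insert r' F" w W xs] by (auto split: if_splits)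
    moreover have "r \<notin> greedy_F w W xs ?F" using Cons.prems(6) by simp
    ultimately have "W < w r + (\<Sum>f | f \<in> greedy_F w W xs ?F \<and> h r \<le> h f. w f)"
      using Cons.prems by (intro Cons.IH) auto
    then show ?thesis by simp
  qed
qed simp

subsection \<open>Lower bounds on the optimum\<close>

text \<open>Rectangles that meet the same horizontal line cannot lie above one another, so their
  horizontal projections do not overlap.\<close>

lemma feasible_line_sum_le:
  assumes "finite S" "\<forall>r\<in>S. 0 < w r \<and> 0 < h r" "0 \<le> W" "feasible S w h W p"
  shows "(\<Sum>r | r \<in> S \<and> snd (p r) \<le> t \<and> t < snd (p r) + h r. w r) \<le> W"
  using assms(4) unfolding feasible_iff[OF assms(2)]
  by (intro disjoint_intervals_sum_le[where x = "\<lambda>r. fst (p r)"])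
    (use assms in \<open>fastforce simp: less_imp_le\<close>)+

lemma feasible_area_le:
  assumes "finite S" "\<forall>r\<in>S. 0 < w r \<and> 0 < h r" "0 \<le> W" "feasible S w h W p"
    and H: "0 \<le> H" "\<And>r. r \<in> S \<Longrightarrow> snd (p r) + h r \<le> H"
  shows "(\<Sum>r\<in>S. w r * h r) \<le> W * H"
proof -
  have y: "0 \<le> snd (p r)" if "r \<in> S" for r using assms(4) that by (auto simp: feasible_def)
  let ?f = "\<lambda>t. \<Sum>r\<in>S. w r * indicator {snd (p r)..<snd (p r) + h r} t"
  have h: "0 \<le> h r" if "r \<in> S" for r using assms(2) that by (auto intro: less_imp_le)
  have "(\<Sum>r\<in>S. w r * h r) = integral\<^sup>L lborel ?f"
    using h by (intro integral_step_sum(2)[symmetric])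
  also have "\<dots> \<le> integral\<^sup>L lborel (\<lambda>t. W * indicator {0..H} t)"
  proof (rule integral_mono)
    show "integrable lborel ?f" using h by (intro integral_step_sum)
    fix t :: real
    have "?f t = (\<Sum>r | r \<in> S \<and> snd (p r) \<le> t \<and> t < snd (p r) + h r. w r)"
      using assms(1) by (intro sum.mono_neutral_cong_right) (auto simp: indicator_def)
    also have "\<dots> \<le> W * indicator {0..H} t"
    proof (cases "t \<in> {0..H}")
      case True
      then show ?thesis using feasible_line_sum_le[OF assms(1-4), of t] by simp
    next
      case False
      then have none: "{r \<in> S. snd (p r) \<le> t \<and> t < snd (p r) + h r} = {}"
        using y H(2) by force
      show ?thesis unfolding none using False by simp
    qed
    finally show "?f t \<le> W * indicator {0..H} t" .
  qed (use H(1) in \<open>auto intro!: integrable_mult_right integrable_real_indicator\<close>)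
  also have "\<dots> = W * H" using H by simp
  finally show ?thesis .
qed

text \<open>Two rectangles wider than half the strip cannot be side by side, so their vertical
  projections do not overlap.\<close>

lemma feasible_wide_heights_le:
  assumes "finite S" "\<forall>r\<in>S. W / 2 < w r \<and> 0 < w r \<and> 0 < h r" "feasible S w h W p"
    and H: "0 \<le> H" "\<And>r. r \<in> S \<Longrightarrow> snd (p r) + h r \<le> H"
  shows "sum h S \<le> H"
proof (rule disjoint_intervals_sum_le[where x = "\<lambda>r. snd (p r)"])
  have pos: "\<forall>r\<in>S. 0 < w r \<and> 0 < h r" using assms(2) by auto
  note f = assms(3)[unfolded feasible_iff[OF pos]]
  show "0 \<le> snd (p r) \<and> snd (p r) + h r \<le> H" if "r \<in> S" for r
    using f that H by auto
  show "snd (p r) + h r \<le> snd (p s) \<or> snd (p s) + h s \<le> snd (p r)"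
    if "r \<in> S" "s \<in> S" "r \<noteq> s" for r s
  proof -
    have "0 \<le> fst (p r)" "fst (p r) + w r \<le> W" "0 \<le> fst (p s)" "fst (p s) + w s \<le> W"
      "W / 2 < w r" "W / 2 < w s"
      using f that assms(2) by auto
    then have "\<not> fst (p r) + w r \<le> fst (p s)" "\<not> fst (p s) + w s \<le> fst (p r)" by linarith+
    with f that show ?thesis by blast
  qed
qed (use assms in \<open>auto simp: less_imp_le\<close>)

text \<open>If \<open>H < 2 * k\<close>, the line at height \<open>H / 2\<close> would meet every
  rectangle of \<open>S\<close>, whose widths do not fit on it.\<close>

lemma feasible_heavy_row_height:
  assumes "finite S" "\<forall>r\<in>S. 0 < w r \<and> 0 < h r \<and> k \<le> h r" "0 \<le> W" "feasible S w h W p"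
    and H: "\<And>r. r \<in> S \<Longrightarrow> snd (p r) + h r \<le> H" and "W < sum w S"
  shows "2 * k \<le> H"
proof (rule ccontr)
  assume "\<not> 2 * k \<le> H"
  then have "{r \<in> S. snd (p r) \<le> H / 2 \<and> H / 2 < snd (p r) + h r} = S"
    using assms(2,4) H by (fastforce simp: feasible_def)
  then show False
    using feasible_line_sum_le[of S w h W p "H / 2"] assms by auto
qed

subsection \<open>Placement by the Bottom-Left algorithm\<close>

text \<open>A position strictly preferred to the chosen one must be infeasible; as the earlier
  rectangles form a feasible packing, one of them overlaps the new rectangle there.\<close>

lemma bottom_left_blocked:
  assumes bl: "bottom_left w h W rs p"
    and dims: "\<forall>r\<in>set rs. 0 < w r \<and> 0 < h r" and "distinct rs"
    and i: "1 \<le> i" "i < length rs"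
    and xy: "0 \<le> x" "x + w (rs ! i) \<le> W" "0 \<le> y" "\<not> bl_le (p (rs ! i)) (x, y)"
  obtains s where "s \<in> set (take i rs)"
    "x < fst (p s) + w s" "fst (p s) < x + w (rs ! i)"
    "y < snd (p s) + h s" "snd (p s) < y + h (rs ! i)"
proof -
  let ?r = "rs ! i" and ?A = "set (take i rs)"
  have A: "set (take (Suc i) rs) = insert ?r ?A" using i by (simp add: take_Suc_conv_app_nth)
  have r: "?r \<notin> ?A" using \<open>distinct rs\<close> i by (auto simp: in_set_conv_nth nth_eq_iff_index_eq)
  have pos: "\<forall>s\<in>insert ?r ?A. 0 < w s \<and> 0 < h s"
    using dims i set_take_subset[of i rs] by auto
  have f: "feasible (insert ?r ?A) w h W p" and nf: "\<not> feasible (insert ?r ?A) w h W (p(?r := (x, y)))"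
    using bl i xy(4) A unfolding bottom_left_def by force+
  show thesis
  proof (rule ccontr)
    assume "\<not> thesis"
    then have "\<forall>s\<in>?A. fst (p s) + w s \<le> x \<or> x + w ?r \<le> fst (p s) \<or>
        snd (p s) + h s \<le> y \<or> y + h ?r \<le> snd (p s)"
      using that by force
    with f nf r xy show False
      unfolding feasible_iff[OF pos] by (auto split: if_splits)
  qed
qed

lemma bottom_left_le_top:
  assumes "bottom_left w h W rs p" "\<forall>r\<in>set rs. 0 < w r \<and> 0 < h r \<and> w r \<le> W" "distinct rs"
    and i: "1 \<le> i" "i < length rs" and "0 \<le> T" "\<And>s. s \<in> set (take i rs) \<Longrightarrow> snd (p s) + h s \<le> T"
  shows "snd (p (rs ! i)) \<le> T"
proof (rule ccontr)
  assume "\<not> snd (p (rs ! i)) \<le> T"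
  then have "\<not> bl_le (p (rs ! i)) (0, T)" by (auto simp: bl_le_def)
  then show False
    using bottom_left_blocked[OF assms(1) _ assms(3) i, of 0 T] assms(2,6,7) i
    by (smt (verit) nth_mem)
qed

lemma bottom_left_floor:
  assumes bl: "bottom_left w h W (fs @ rs) p" and "\<forall>r\<in>set (fs @ rs). 0 < w r \<and> 0 < h r"
    and "distinct (fs @ rs)" "sum w (set fs) \<le> W" "i < length fs"
  shows "snd (p (fs ! i)) = 0 \<and> fst (p (fs ! i)) \<le> sum w (set (take i fs))"
  using \<open>i < length fs\<close>
proof (induction i rule: less_induct)
  case (less i)
  let ?x = "sum w (set (take i fs))"
  have nth: "(fs @ rs) ! i = fs ! i" "take i (fs @ rs) = take i fs"
    using less.prems by (auto simp: nth_append)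
  show ?case
  proof (cases "i = 0")
    case True
    then show ?thesis using bl less.prems nth(1) unfolding bottom_left_def by auto
  next
    case False
    then have i: "1 \<le> i" "i < length (fs @ rs)" using less.prems by auto
    have add: "sum w (set (take (Suc j) fs)) = sum w (set (take j fs)) + w (fs ! j)" if "j < length fs" for j
    proof -
      have "fs ! j \<notin> set (take j fs)"
        using assms(3) that by (auto simp: in_set_conv_nth nth_eq_iff_index_eq)
      then show ?thesis using that by (simp add: take_Suc_conv_app_nth)
    qed
    have mono: "sum w A \<le> sum w B" if "A \<subseteq> B" "B \<subseteq> set fs" for A B
      using that assms(2) finite_subset[OF that(2)] by (intro sum_mono2) (auto intro: less_imp_le)
    \<comment> \<open>The floor is free from \<open>?x\<close> on, since every earlier rectangle
      ends within its own prefix sum.\<close>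
    have "bl_le (p (fs ! i)) (?x, 0)"
    proof (rule ccontr)
      assume "\<not> ?thesis"
      then have n: "\<not> bl_le (p ((fs @ rs) ! i)) (?x, 0)" using nth by simp
      have "0 \<le> ?x" using mono[of "{}" "set (take i fs)"] set_take_subset[of i fs] by simp
      moreover have "?x + w (fs ! i) \<le> W"
        using add[OF less.prems] mono[of "set (take (Suc i) fs)" "set fs"] assms(4)
          set_take_subset[of "Suc i" fs] by simp
      ultimately obtain s where s: "s \<in> set (take i fs)" "?x < fst (p s) + w s"
        using nth by - (rule bottom_left_blocked[OF bl assms(2,3) i _ _ _ n], auto)
      then obtain j where j: "j < i" "s = fs ! j" using less.prems by (auto simp: in_set_conv_nth)
      then have "fst (p s) + w s \<le> sum w (set (take (Suc j) fs))"
        using less.IH[of j] less.prems add[of j] by simp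
      also have "\<dots> \<le> ?x"
        using j by (intro mono set_take_subset_set_take set_take_subset) auto
      finally show False using s by simp
    qed
    moreover have "0 \<le> snd (p (fs ! i))"
      using bl i nth less.prems unfolding bottom_left_def feasible_def
      by (auto simp: take_Suc_conv_app_nth)
    ultimately show ?thesis by (auto simp: bl_le_def)
  qed
qed

subsection \<open>The density of a horizontal line\<close>

text \<open>The interface for the line argument: \<open>stack\<close> replaces the left-to-right
  order of \<open>F\<close>, and \<open>blocked\<close> replaces the recursion of the algorithm for
  the members of \<open>qs\<close>.\<close>

locale floor_packing =
  fixes F :: "'r set" and qs :: "'r list" and w h :: "'r \<Rightarrow> real" and W :: real
    and p :: "'r \<Rightarrow> real \<times> real"
  assumes W_pos: "0 < W"
    and finite_F: "finite F"
    and dims: "\<forall>r\<in>F \<union> set qs. 0 < w r \<and> 0 < h r"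
    and disj: "distinct qs" "F \<inter> set qs = {}"
    and narrow: "\<And>r. r \<in> set qs \<Longrightarrow> w r \<le> W / 2"
    and sorted: "sorted_wrt (\<lambda>r s. w r \<ge> w s) qs"
    and floor: "\<And>f. f \<in> F \<Longrightarrow> snd (p f) = 0"
    and stack: "\<And>f. f \<in> F \<Longrightarrow> fst (p f) + w f \<le> (\<Sum>g | g \<in> F \<and> h f \<le> h g. w g)"
    and rejected: "\<And>r. r \<in> set qs \<Longrightarrow> W < w r + (\<Sum>f | f \<in> F \<and> h r \<le> h f. w f)"
    and feas: "feasible (F \<union> set qs) w h W p"
    and blocked: "\<And>j x y. \<lbrakk>j < length qs; 0 \<le> x; x + w (qs ! j) \<le> W; 0 \<le> y; \<not> bl_le (p (qs ! j)) (x, y)\<rbrakk> \<Longrightarrow>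
      \<exists>s \<in> F \<union> set (take j qs). x < fst (p s) + w s \<and> fst (p s) < x + w (qs ! j) \<and>
        y < snd (p s) + h s \<and> snd (p s) < y + h (qs ! j)"
begin

definition tall :: "real \<Rightarrow> real" where
  "tall t = (\<Sum>f | f \<in> F \<and> t < h f. w f)"

text \<open>For \<open>0 \<le> t\<close> this is the covered length of the line at height
  \<open>t\<close> just before \<open>qs ! n\<close> is placed; \<open>F\<close> contributes
  \<open>tall t\<close> because it stands on the floor.\<close>

definition cov :: "nat \<Rightarrow> real \<Rightarrow> real" where
  "cov n t = tall t + (\<Sum>s | s \<in> set (take n qs) \<and> snd (p s) \<le> t \<and> t < snd (p s) + h s. w s)"

lemma tall_nonneg: "0 \<le> tall t"
  unfolding tall_def using dims by (intro sum_nonneg) (auto intro: less_imp_le)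

lemma tall_antimono: "s \<le> t \<Longrightarrow> tall t \<le> tall s"
  unfolding tall_def using dims finite_F by (intro sum_mono2) (auto intro: less_imp_le)

lemma right_le_tall:
  assumes "f \<in> F" "t < h f"
  shows "fst (p f) + w f \<le> tall t"
proof -
  have "(\<Sum>g | g \<in> F \<and> h f \<le> h g. w g) \<le> tall t"
    unfolding tall_def using dims finite_F assms by (intro sum_mono2) (auto intro: less_imp_le)
  with stack[OF assms(1)] show ?thesis by simp
qed

lemma rejected_tall:
  assumes "r \<in> set qs" "t < h r"
  shows "W - w r < tall t"
proof -
  have "(\<Sum>g | g \<in> F \<and> h r \<le> h g. w g) \<le> tall t"
    unfolding tall_def using dims finite_F assms by (intro sum_mono2) (auto intro: less_imp_le)
  with rejected[OF assms(1)] show ?thesis by simp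
qed

lemma pos_dims: "r \<in> F \<union> set qs \<Longrightarrow> 0 < w r" "r \<in> F \<union> set qs \<Longrightarrow> 0 < h r"
  using dims by auto

lemma feas_inside:
  assumes "r \<in> F \<union> set qs"
  shows "0 \<le> fst (p r)" "fst (p r) + w r \<le> W" "0 \<le> snd (p r)"
  using feas assms unfolding feasible_iff[OF dims] by auto

lemma feas_apart:
  assumes "r \<in> F \<union> set qs" "s \<in> F \<union> set qs" "r \<noteq> s"
  shows "fst (p r) + w r \<le> fst (p s) \<or> fst (p s) + w s \<le> fst (p r) \<or>
     snd (p r) + h r \<le> snd (p s) \<or> snd (p s) + h s \<le> snd (p r)"
  using feas assms unfolding feasible_iff[OF dims] by blast

text \<open>Otherwise \<open>qs ! j\<close> could slide left at the same height, which contradicts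
  the choice of its position.\<close>

lemma left_toucher:
  assumes j: "j < length qs" and b: "0 < fst (p (qs ! j))"
  obtains C where "C \<in> F \<union> set (take j qs)" "fst (p C) + w C = fst (p (qs ! j))"
    "snd (p C) < snd (p (qs ! j)) + h (qs ! j)" "snd (p (qs ! j)) < snd (p C) + h C"
proof -
  let ?B = "qs ! j"
  define L where "L = {s \<in> F \<union> set (take j qs). snd (p s) < snd (p ?B) + h ?B \<and>
    snd (p ?B) < snd (p s) + h s \<and> fst (p s) + w s \<le> fst (p ?B)}"
  \<comment> \<open>The rightmost obstacle to the left of \<open>?B\<close>; the value
    \<open>0\<close> stands for the wall of the strip.\<close>
  define x0 where "x0 = Max (insert 0 ((\<lambda>s. fst (p s) + w s) ` L))"
  have fin: "finite L" using finite_F by (simp add: L_def)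
  have B: "?B \<in> F \<union> set qs" using j by simp
  have x0: "0 \<le> x0" "\<And>s. s \<in> L \<Longrightarrow> fst (p s) + w s \<le> x0" "x0 \<le> fst (p ?B)"
    using fin b by (auto simp: x0_def L_def)
  have "x0 = fst (p ?B)"
  proof (rule ccontr)
    assume "x0 \<noteq> fst (p ?B)"
    then have lt: "x0 < fst (p ?B)" using x0 by simp
    then have "\<not> bl_le (p ?B) (x0, snd (p ?B))" by (simp add: bl_le_def)
    moreover have "x0 + w ?B \<le> W" "0 \<le> snd (p ?B)" using lt feas_inside[OF B] by auto
    ultimately obtain s where s: "s \<in> F \<union> set (take j qs)" "x0 < fst (p s) + w s" "fst (p s) < x0 + w ?B"
        "snd (p ?B) < snd (p s) + h s" "snd (p s) < snd (p ?B) + h ?B"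
      using blocked[OF j, of x0 "snd (p ?B)"] x0(1) by blast
    have "?B \<notin> F" using disj(2) nth_mem[OF j] by blast
    moreover have "?B \<notin> set (take j qs)"
      using disj(1) j by (auto simp: in_set_conv_nth nth_eq_iff_index_eq)
    ultimately have "s \<noteq> ?B" "s \<in> F \<union> set qs"
      using s(1) set_take_subset[of j qs] by auto
    then have "fst (p s) + w s \<le> fst (p ?B) \<or> fst (p ?B) + w ?B \<le> fst (p s)"
      using feas_apart[OF _ B, of s] s(4,5) by linarith
    then show False
    proof
      assume "fst (p s) + w s \<le> fst (p ?B)"
      then have "s \<in> L" using s by (simp add: L_def)
      with x0(2) s(2) show False by force
    qed (use s(3) lt in linarith)
  qed
  moreover have "x0 \<in> insert 0 ((\<lambda>s. fst (p s) + w s) ` L)"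
    unfolding x0_def using fin by (intro Max_in) auto
  ultimately obtain C where "C \<in> L" "fst (p C) + w C = fst (p ?B)" using b by auto
  then show thesis using that by (auto simp: L_def)
qed

text \<open>The two bounds match the two cases of \<open>g (t - k)\<close> for the truncation
  \<open>g = min a (W / 3)\<close>. The first also yields \<open>tall t < W / 3\<close>, so that
  \<open>g t\<close> is not truncated.\<close>

lemma sparse_line:
  assumes n: "n < length qs" and t: "0 \<le> t" "t < snd (p (qs ! n))" and sparse: "2 * cov n t < W"
    and k: "\<And>r. r \<in> set qs \<Longrightarrow> h r \<le> k"
  shows "W - 2 * cov n t + tall t \<le> W / 3" "W - 2 * cov n t \<le> tall (t - k) - tall t"
proof -
  define m where "m = (LEAST i. t < snd (p (qs ! i)))"
  \<comment> \<open>When \<open>qs ! m\<close> is placed, everything present starts at height at most \<open>t\<close>, so a gap on the line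
    is free all the way up, and hence shorter than \<open>v = w (qs ! m)\<close>.\<close>
  have mn: "m \<le> n" unfolding m_def by (intro Least_le t)
  have m: "m < length qs" "t < snd (p (qs ! m))"
    using mn n LeastI[of "\<lambda>i. t < snd (p (qs ! i))", OF t(2)] by (auto simp: m_def)
  define v where "v = w (qs ! m)"
  have v: "0 < v" "v \<le> W / 2" using dims narrow m by (auto simp: v_def)
  have earlier: "snd (p s) \<le> t \<and> v \<le> w s \<and> s \<in> set qs" if s: "s \<in> set (take m qs)" for s
  proof -
    obtain i where i: "i < m" "s = qs ! i" using s m by (auto simp: in_set_conv_nth)
    then have "snd (p s) \<le> t" using not_less_Least[of i "\<lambda>i. t < snd (p (qs ! i))"] by (auto simp: m_def)
    moreover have "v \<le> w s" using sorted i m by (auto simp: v_def sorted_wrt_iff_nth_less)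
    ultimately show ?thesis using i m by auto
  qed
  define X where "X = {s \<in> set (take m qs). t < snd (p s) + h s}"
  define S where "S = sum w X"
  have fin: "finite X" by (simp add: X_def)
  have X: "snd (p s) \<le> t" "t < snd (p s) + h s" "v \<le> w s" "s \<in> set qs" if "s \<in> X" for s
    using that earlier by (auto simp: X_def)
  \<comment> \<open>Here \<open>x\<close> is the left end of a trial position of
    \<open>qs ! m\<close> at height \<open>t\<close>. Extending every obstacle in \<open>X\<close>
    by \<open>v\<close> to the left turns blocked trials into covered points.\<close>
  have cover: "(\<exists>s\<in>F. t < h s \<and> x < fst (p s) + w s) \<or>
      (\<exists>s\<in>X. fst (p s) - v < x \<and> x < fst (p s) + w s)" if x: "0 \<le> x" "x \<le> W - v" for x
  proof -
    have "\<not> bl_le (p (qs ! m)) (x, t)" using m by (simp add: bl_le_def)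
    then obtain s where s: "s \<in> F \<union> set (take m qs)" "x < fst (p s) + w s" "fst (p s) < x + v"
        "t < snd (p s) + h s"
      using blocked[OF m(1), of x t] x t(1) by (auto simp: v_def)
    show ?thesis
    proof (cases "s \<in> F")
      case True
      then show ?thesis using s floor by auto
    next
      case False
      then have "s \<in> X" using s by (auto simp: X_def)
      with s show ?thesis by force
    qed
  qed
  have coverX: "\<exists>s\<in>X. fst (p s) - v < x \<and> x < fst (p s) + w s" if "tall t \<le> x" "x \<le> W - v" for x
    using cover[of x] that tall_nonneg[of t] right_le_tall[of _ t] by force
  have cov: "tall t + S \<le> cov n t"
    unfolding cov_def S_def
  proof (intro add_left_mono sum_mono2)
    show "X \<subseteq> {s \<in> set (take n qs). snd (p s) \<le> t \<and> t < snd (p s) + h s}"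
      using earlier mn set_take_subset_set_take[of m n qs] by (auto simp: X_def)
    show "0 \<le> w s" if "s \<in> {s \<in> set (take n qs). snd (p s) \<le> t \<and> t < snd (p s) + h s} - X" for s
      using that dims set_take_subset[of n qs] by (auto intro: less_imp_le)
  qed simp
  have card: "real (card X) * v \<le> S"
    unfolding S_def using sum_bounded_below[of X v w] X(3) by simp
  have "0 \<le> S" using card v by (smt (verit) mult_nonneg_nonneg of_nat_0_le_iff)
  then have tall_le: "tall t \<le> W - v" using cov sparse v by linarith
  then have "X \<noteq> {}" using coverX[of "tall t"] by auto
  then obtain B where B: "B \<in> X" "\<And>s. s \<in> X \<Longrightarrow> fst (p B) \<le> fst (p s)"
    using ex_min_if_finite[of "(\<lambda>s. fst (p s)) ` X"] fin by (auto simp: not_less)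
  have vS: "v \<le> S"
    unfolding S_def using X(3)[OF B(1)] member_le_sum[of B X w] B(1) fin X(4) dims
    by (force intro: less_imp_le)
  have "W - v - tall t \<le> (\<Sum>s\<in>X. (fst (p s) + w s) - (fst (p s) - v))"
    by (intro interval_cover_le_sum fin)
      (use coverX X(3) v in \<open>force intro: less_imp_le\<close>)+
  also have "\<dots> = S + real (card X) * v" by (simp add: S_def sum.distrib)
  finally have all_gaps: "W - v - tall t \<le> S + real (card X) * v" .
  \<comment> \<open>Both \<open>v\<close> and \<open>real (card X) * v\<close> are at most
    \<open>S\<close>, hence \<open>W - tall t \<le> 3 * S\<close>, and the left side is at most a
    third of \<open>W - tall t\<close>.\<close>
  then show "W - 2 * cov n t + tall t \<le> W / 3"
    using card cov vS tall_nonneg[of t] v by linarith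

  define b where "b = fst (p B)"
  \<comment> \<open>From \<open>b\<close> on, the interval of the leftmost rectangle
    \<open>B\<close> needs no extension; the \<open>v\<close> saved cancels the \<open>v\<close>
    lost at the right end of the strip.\<close>
  let ?l = "\<lambda>s. if s = B then b else fst (p s) - v"
  have "W - v - max (tall t) b \<le> (\<Sum>s\<in>X. (fst (p s) + w s) - ?l s)"
  proof (intro interval_cover_le_sum fin)
    show "?l s \<le> fst (p s) + w s" if "s \<in> X" for s using X(3)[OF that] v by (auto simp: b_def)
    show "{max (tall t) b..W - v} \<subseteq> (\<Union>s\<in>X. {?l s..fst (p s) + w s})"
      using coverX by (force intro: less_imp_le)
  qed
  also have "\<dots> = (\<Sum>s\<in>X. w s + v - (if s = B then v else 0))"
    by (intro sum.cong) (auto simp: b_def)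
  also have "\<dots> = S + real (card X) * v - v"
    using B(1) fin by (simp add: S_def sum.distrib sum_subtractf)
  finally have "W - max (tall t) b \<le> 2 * S" using card by linarith
  \<comment> \<open>With \<open>b \<le> tall t\<close> the last bound would give
    \<open>W \<le> 2 * cov n t\<close>. So the maximum is \<open>b\<close>, and sparsity makes
    \<open>b\<close> exceed \<open>2 * tall t\<close>.\<close>
  then have gap: "W - 2 * cov n t \<le> b - 2 * tall t" and b: "2 * tall t < b"
    using cov sparse tall_nonneg[of t] by linarith+

  obtain j where j: "j < m" "B = qs ! j" using B(1) m by (auto simp: X_def in_set_conv_nth)
  obtain C where C: "C \<in> F \<union> set (take j qs)" "fst (p C) + w C = b"
      "snd (p C) < snd (p B) + h B" "snd (p B) < snd (p C) + h C"
    using left_toucher[of j] j m b tall_nonneg[of t] by (auto simp: b_def)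
  have "C \<in> F"
  proof (rule ccontr)
    assume "C \<notin> F"
    then have Cm: "C \<in> set (take m qs)" using C(1) j set_take_subset_set_take[of j m qs] by auto
    have Cqs: "C \<in> F \<union> set qs" and wC: "v \<le> w C" using earlier[OF Cm] by auto
    have "C \<notin> X" using B(2)[of C] C(2) pos_dims[OF Cqs] by (auto simp: b_def)
    then have top: "snd (p C) + h C \<le> t" using Cm by (auto simp: X_def)
    have "fst (p C) \<le> W - v" using feas_inside[OF Cqs] wC by linarith
    \<comment> \<open>\<open>C\<close> lies below the line and bounds a gap of width at least \<open>v\<close>.\<close>
    from cover[OF feas_inside(1)[OF Cqs] this] show False
    proof (elim disjE bexE conjE)
      \<comment> \<open>\<open>C\<close> starts below the top of \<open>s\<close>, so
        \<open>s\<close> must lie to the right of \<open>C\<close> and end beyond \<open>b\<close>,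
        whereas \<open>right_le_tall\<close> stops it at \<open>tall t\<close>.\<close>
      fix s assume s: "s \<in> F" "t < h s" "fst (p C) < fst (p s) + w s"
      then have "s \<noteq> C" using \<open>C \<notin> F\<close> by auto
      then show False
        using feas_apart[of s C] s Cqs floor[OF s(1)] top pos_dims[OF Cqs] feas_inside[OF Cqs]
          right_le_tall[OF s(1,2)] C(2) b tall_nonneg[of t] pos_dims(1)[of s] by auto
    next
      fix s assume "s \<in> X" "fst (p s) - v < fst (p C)"
      then show False using B(2)[of s] C(2) wC by (simp add: b_def)
    qed
  qed
  \<comment> \<open>\<open>B\<close> crosses the line, so it starts above \<open>t - k\<close>; its
    neighbour \<open>C\<close> stands on the floor and reaches above that start.\<close>
  then have "t - k < h C" using floor C(4) X(2)[OF B(1)] k[OF X(4)[OF B(1)]] by force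
  then have "b \<le> tall (t - k)" using right_le_tall[OF \<open>C \<in> F\<close>] C(2) by simp
  with gap show "W - 2 * cov n t \<le> tall (t - k) - tall t" using tall_nonneg[of t] by linarith
qed

text \<open>Integrates a pointwise bound on the covered length over all heights; the area of
  \<open>qs ! n\<close> itself makes up for the lines below \<open>h (qs ! n)\<close>.\<close>

lemma narrow_top_le:
  assumes n: "n < length qs" and k: "k \<in> h ` set qs" "\<And>r. r \<in> set qs \<Longrightarrow> h r \<le> k"
  shows "W * (snd (p (qs ! n)) + h (qs ! n)) \<le> 2 * (\<Sum>r\<in>F \<union> set qs. w r * h r) + W * k / 3"
proof -
  let ?q = "qs ! n"
  let ?y = "snd (p ?q)" and ?Q = "set (take n qs)"
  \<comment> \<open>If \<open>qs ! n\<close> starts below its own height, the second interval of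
    \<open>?E\<close> is empty.\<close>
  let ?M = "max (h ?q) ?y"
  define a where "a = (\<lambda>t::real. \<Sum>f\<in>F. w f * indicator {0..<h f} t)"
  define c where "c = (\<lambda>t::real. \<Sum>s\<in>?Q. w s * indicator {snd (p s)..<snd (p s) + h s} t)"
  define g where "g = (\<lambda>t. min (a t) (W / 3))"
  have q: "?q \<in> set qs" "?q \<notin> ?Q"
    using n disj by (auto simp: in_set_conv_nth nth_eq_iff_index_eq)
  have Q: "?Q \<subseteq> set qs" by (rule set_take_subset)
  have kpos: "0 < k" using k(1) dims by auto
  have a_neg: "a t = 0" if "t < 0" for t using that by (auto simp: a_def)
  have a_tall: "a t = tall t" if "0 \<le> t" for t
    unfolding a_def tall_def using that finite_F
    by (intro sum.mono_neutral_cong_right) (auto simp: indicator_def)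
  have c_nonneg: "0 \<le> c t" for t
    unfolding c_def using Q dims by (intro sum_nonneg mult_nonneg_nonneg) (auto intro: less_imp_le)
  have cov: "cov n t = a t + c t" if "0 \<le> t" for t
  proof -
    have "c t = (\<Sum>s | s \<in> ?Q \<and> snd (p s) \<le> t \<and> t < snd (p s) + h s. w s)"
      unfolding c_def by (intro sum.mono_neutral_cong_right) (auto simp: indicator_def)
    then show ?thesis using a_tall[OF that] by (simp add: cov_def)
  qed
  have a_int: "integrable lborel a" "integral\<^sup>L lborel a = (\<Sum>f\<in>F. w f * h f)"
    unfolding a_def using integral_step_sum[of F h w "\<lambda>_. 0"] dims by (auto simp: less_imp_le)
  have c_int: "integrable lborel c" "integral\<^sup>L lborel c = (\<Sum>s\<in>?Q. w s * h s)"
    unfolding c_def by (intro integral_step_sum; use dims Q in \<open>auto simp: less_imp_le subset_iff\<close>)+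
  have g_int: "integrable lborel g"
  proof (rule Bochner_Integration.integrable_bound[OF a_int(1)])
    show "g \<in> borel_measurable lborel"
      using borel_measurable_integrable[OF a_int(1)] unfolding g_def by simp
    have "0 \<le> a t" for t using a_neg[of t] a_tall[of t] tall_nonneg[of t] by (cases "t < 0") auto
    then show "AE t in lborel. norm (g t) \<le> norm (a t)" using W_pos by (auto simp: g_def)
  qed
  have g_shift: "integrable lborel (\<lambda>t. g (t - k))" "integral\<^sup>L lborel (\<lambda>t. g (t - k)) = integral\<^sup>L lborel g"
    using lborel_integrable_real_affine[OF g_int, of 1 "-k"] lborel_integral_real_affine[of 1 g "-k"]
    by simp_all
  \<comment> \<open>The two terms in \<open>g\<close> cancel under the integral. The indicator term,
    with integral \<open>W * k / 3\<close>, offsets \<open>- g t\<close> for \<open>t < k\<close>,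
    where \<open>g (t - k)\<close> is zero.\<close>
  let ?D = "\<lambda>t. 2 * a t + 2 * c t + g (t - k) - g t + W / 3 * indicator {0..<k} t"
  let ?E = "\<lambda>t. 2 * (W - w ?q) * indicator {0..<h ?q} t + W * indicator {h ?q..<?M} t"
  have le: "?E t \<le> ?D t" for t
  proof (cases "t < 0")
    case True
    moreover have "0 < h ?q" using dims q by auto
    ultimately have "?E t = 0" by simp
    with True show ?thesis using a_neg c_nonneg[of t] kpos W_pos by (simp add: g_def)
  next
    case False
    then have t: "0 \<le> t" by simp
    have shift: "0 \<le> g (t - k) - g t + W / 3 * indicator {0..<k} t"
    proof (cases "t < k")
      case True
      then show ?thesis using a_neg[of "t - k"] t W_pos by (auto simp: g_def)
    next
      case False
      then show ?thesis
        using a_tall[of t] a_tall[of "t - k"] tall_antimono[of "t - k" t] kpos t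
        by (auto simp: g_def)
    qed
    consider "t < h ?q" | "h ?q \<le> t" "t < ?y" | "h ?q \<le> t" "?y \<le> t" by linarith
    then show ?thesis
    proof cases
      case 1
      then show ?thesis
        using rejected_tall[OF q(1), of t] a_tall[OF t] c_nonneg[of t] shift t by auto
    next
      case 2
      then have E: "?E t = W" by auto
      show ?thesis
      proof (cases "W \<le> 2 * cov n t")
        case True
        then show ?thesis unfolding E using shift cov[OF t] by linarith
      next
        case False
        then have sparse: "2 * cov n t < W" by simp
        \<comment> \<open>Below \<open>k\<close> the rectangles of \<open>F\<close> alone cover more
          than half of the line.\<close>
        have "k \<le> t"
        proof (rule ccontr)
          assume "\<not> k \<le> t"
          then obtain r where "r \<in> set qs" "t < h r" using k(1) by auto
          then have "W / 2 < tall t" using rejected_tall[of r t] narrow[of r] by linarith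
          then show False using sparse cov[OF t] a_tall[OF t] c_nonneg[of t] by linarith
        qed
        then have "g t = tall t" "g (t - k) = min (tall (t - k)) (W / 3)"
          using sparse_line(1)[OF n t 2(2) sparse k(2)] sparse a_tall[OF t] a_tall[of "t - k"]
          by (auto simp: g_def)
        then have "W - 2 * cov n t \<le> g (t - k) - g t"
          using sparse_line[OF n t 2(2) sparse k(2)] by auto
        then show ?thesis unfolding E using cov[OF t] \<open>k \<le> t\<close> by simp
      qed
    next
      case 3
      then have E: "?E t = 0" by auto
      have "0 \<le> a t" using a_tall[OF t] tall_nonneg[of t] by simp
      then show ?thesis unfolding E using shift c_nonneg[of t] by linarith
    qed
  qed
  have "2 * (W - w ?q) * h ?q + W * (?M - h ?q) = integral\<^sup>L lborel ?E"
    using dims q by (simp add: less_imp_le)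
  also have "\<dots> \<le> integral\<^sup>L lborel ?D"
  proof (rule integral_mono)
    show "integrable lborel ?E"
      by (intro Bochner_Integration.integrable_add integrable_mult_right integrable_real_indicator)
        (use dims q in \<open>auto simp: less_imp_le\<close>)
    show "integrable lborel ?D"
      by (intro Bochner_Integration.integrable_add Bochner_Integration.integrable_diff
          integrable_mult_right integrable_real_indicator a_int c_int g_int g_shift) (use kpos in auto)
  qed (rule le)
  also have "\<dots> = 2 * (\<Sum>f\<in>F. w f * h f) + 2 * (\<Sum>s\<in>?Q. w s * h s) + W / 3 * k"
    using a_int c_int g_int g_shift kpos by simp
  finally have bound: "2 * (W - w ?q) * h ?q + W * (?M - h ?q) \<le>
    2 * ((\<Sum>f\<in>F. w f * h f) + (\<Sum>s\<in>?Q. w s * h s)) + W * k / 3" by simp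
  have "(\<Sum>f\<in>F. w f * h f) + (\<Sum>s\<in>?Q. w s * h s) + w ?q * h ?q = (\<Sum>r\<in>F \<union> insert ?q ?Q. w r * h r)"
    using finite_F q Q disj by (subst sum.union_disjoint) auto
  also have "\<dots> \<le> (\<Sum>r\<in>F \<union> set qs. w r * h r)"
    using finite_F q Q dims by (intro sum_mono2) (auto intro: less_imp_le)
  finally have area: "(\<Sum>f\<in>F. w f * h f) + (\<Sum>s\<in>?Q. w s * h s) + w ?q * h ?q \<le> (\<Sum>r\<in>F \<union> set qs. w r * h r)" .
  have "W * (?y + h ?q) \<le> W * (?M + h ?q)" using W_pos by (intro mult_left_mono) auto
  \<comment> \<open>Adding \<open>2 * w ?q * h ?q\<close> restores the full weight
    \<open>2 * W\<close> on the heights below \<open>h ?q\<close>.\<close>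
  also have "\<dots> = 2 * (W - w ?q) * h ?q + W * (?M - h ?q) + 2 * (w ?q * h ?q)" by algebra
  also have "\<dots> \<le> 2 * ((\<Sum>f\<in>F. w f * h f) + (\<Sum>s\<in>?Q. w s * h s)) + W * k / 3 + 2 * (w ?q * h ?q)"
    using bound by (rule add_right_mono)
  also have "\<dots> = 2 * ((\<Sum>f\<in>F. w f * h f) + (\<Sum>s\<in>?Q. w s * h s) + w ?q * h ?q) + W * k / 3"
    by (simp only: distrib_left add_ac)
  also have "\<dots> \<le> 2 * (\<Sum>r\<in>F \<union> set qs. w r * h r) + W * k / 3"
    using area by (intro add_right_mono mult_left_mono) auto
  finally show ?thesis .
qed

end

subsection \<open>The approximation ratio\<close>

theorem theorem1:
  fixes R :: "'r set" and w h :: "'r \<Rightarrow> real" and W :: real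
    and rs :: "'r list" and p :: "'r \<Rightarrow> real \<times> real"
  assumes "strip_instance R w h W"
    and "FQW_ordering R w h W rs"
    and "bottom_left w h W rs p"
  shows "packing_height R h p \<le> 13 / 6 * opt_height R w h W"
proof (cases "R = {}")
  case True
  then show ?thesis using opt_height_attained[OF assms(1)] by (auto simp: packing_height_def)
next
  case False
  note bl = assms(3)
  have R: "0 < W" "finite R" "\<forall>r\<in>R. 0 < w r \<and> 0 < h r" "\<forall>r\<in>R. 0 < w r \<and> 0 < h r \<and> w r \<le> W"
    using assms(1) by (auto simp: strip_instance_def)
  define H where "H = opt_height R w h W"
  obtain p' where p': "feasible R w h W p'" "packing_height R h p' = H"
    using opt_height_attained[OF assms(1)] by (auto simp: H_def)
  have top: "snd (p' r) + h r \<le> H" if "r \<in> R" for r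
    using feasible_height_bounds[OF R(2) that, of p' h] p'(2) by simp
  have hH: "h r \<le> H" if "r \<in> R" for r
    using top[OF that] p'(1) that by (auto simp: feasible_def)
  have H0: "0 \<le> H" using False hH R(3) by (meson ex_in_conv less_imp_le order_trans)

  obtain \<F> \<Q> \<W> fs qs ws where FQW: "FQW_partition R w h W \<F> \<Q> \<W>" and rs: "rs = fs @ qs @ ws"
    and fs: "ordering_of \<F> fs" "sorted_wrt (\<lambda>r s. h r \<ge> h s) fs"
    and qs: "ordering_of \<Q> qs" "sorted_wrt (\<lambda>r s. w r \<ge> w s) qs" and ws: "ordering_of \<W> ws"
    using assms(2) unfolding FQW_ordering_def by blast
  obtain xs where xs: "ordering_of R xs" "sorted_wrt (\<lambda>r s. h r \<ge> h s) xs" "\<F> = greedy_F w W xs {}"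
    and parts: "\<W> = {r \<in> R - \<F>. w r > W / 2}" "\<Q> = R - (\<F> \<union> \<W>)"
    using FQW unfolding FQW_partition_def by blast
  have FR: "\<F> \<subseteq> R" using greedy_F_subset(2)[of w W xs "{}"] xs by (auto simp: ordering_of_def)
  have sets: "set fs = \<F>" "set qs = \<Q>" "set ws = \<W>" "distinct fs" "distinct qs" "distinct ws"
    using fs qs ws by (auto simp: ordering_of_def)
  have R_eq: "R = \<F> \<union> \<Q> \<union> \<W>" and QR: "\<Q> \<subseteq> R" and WR: "\<W> \<subseteq> R"
    and apart: "\<F> \<inter> \<Q> = {}" "(\<F> \<union> \<Q>) \<inter> \<W> = {}"
    using FR parts by auto
  have set_rs: "set rs = R" and dist: "distinct rs" using R_eq apart sets by (auto simp: rs)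
  have rs_dims: "\<forall>r\<in>set rs. 0 < w r \<and> 0 < h r" "\<forall>r\<in>set rs. 0 < w r \<and> 0 < h r \<and> w r \<le> W"
    using R set_rs by auto
  have fins: "finite \<F>" "finite \<Q>" "finite \<W>" using FR QR WR R(2) by (auto intro: finite_subset)
  have sumF: "sum w \<F> \<le> W" using greedy_F_sum_le[of "{}" w W xs] R(1) xs(3) by simp
  have rej: "W < w r + (\<Sum>f | f \<in> \<F> \<and> h r \<le> h f. w f)" if "r \<in> R - \<F>" for r
    using greedy_F_rejected[of "{}" h xs w r W] that xs R(3) by (auto simp: ordering_of_def less_imp_le)
  \<comment> \<open>With \<open>\<F>\<close> empty, a rejected rectangle would be wider than
    \<open>W\<close>. Thus no member of \<open>\<Q>\<close> or \<open>\<W>\<close> has index 0,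
    which \<open>bottom_left\<close> treats separately.\<close>
  have "\<F> \<noteq> {}" using rej False R(4) by force
  then have fs0: "1 \<le> length fs" using sets by (cases fs) auto

  have on_floor: "snd (p (fs ! i)) = 0 \<and> fst (p (fs ! i)) \<le> sum w (set (take i fs))" if "i < length fs" for i
    using bottom_left_floor[of w h W fs "qs @ ws" p i] bl rs_dims dist sets sumF that by (simp add: rs)

  interpret floor_packing \<F> qs w h W p
  proof
    show "snd (p f) = 0" if "f \<in> \<F>" for f
      using on_floor that sets by (metis in_set_conv_nth)
    show "fst (p f) + w f \<le> (\<Sum>g | g \<in> \<F> \<and> h f \<le> h g. w g)" if f: "f \<in> \<F>" for f
    proof -
      obtain i where i: "i < length fs" "f = fs ! i" using f sets by (metis in_set_conv_nth)
      have "f \<notin> set (take i fs)"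
        using i sets by (auto simp: in_set_conv_nth nth_eq_iff_index_eq)
      then have "fst (p f) + w f \<le> sum w (insert f (set (take i fs)))"
        using on_floor[OF i(1)] i by simp
      also have "\<dots> \<le> (\<Sum>g | g \<in> \<F> \<and> h f \<le> h g. w g)"
      proof (intro sum_mono2)
        show "insert f (set (take i fs)) \<subseteq> {g \<in> \<F>. h f \<le> h g}"
          using fs(2) i f sets set_take_subset[of i fs]
          by (auto simp: sorted_wrt_iff_nth_less in_set_conv_nth)
      qed (use fins R FR in \<open>auto intro: less_imp_le\<close>)
      finally show ?thesis .
    qed
    show "feasible (\<F> \<union> set qs) w h W p"
      using rs_dims(2) by (intro feasible_mono[OF bottom_left_feasible[OF _ bl]]) (auto simp: rs sets)
    show "\<exists>s \<in> \<F> \<union> set (take j qs). x < fst (p s) + w s \<and> fst (p s) < x + w (qs ! j) \<and>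
        y < snd (p s) + h s \<and> snd (p s) < y + h (qs ! j)"
      if "j < length qs" "0 \<le> x" "x + w (qs ! j) \<le> W" "0 \<le> y" "\<not> bl_le (p (qs ! j)) (x, y)" for j x y
    proof -
      have nth: "rs ! (length fs + j) = qs ! j" "take (length fs + j) rs = fs @ take j qs"
        using that(1) by (auto simp: rs nth_append)
      have i: "1 \<le> length fs + j" "length fs + j < length rs" using that(1) fs0 by (auto simp: rs)
      show ?thesis
        using that(2-5) nth sets
        by (metis Un_iff set_append bottom_left_blocked[OF bl rs_dims(1) dist i, of x y])
    qed
  qed (use R FR QR fins apart sets qs(2) rej parts in auto)

  have heavy: "2 * h r \<le> H" if "r \<in> \<Q>" for r
  proof (rule feasible_heavy_row_height)
    let ?S = "insert r {f \<in> \<F>. h r \<le> h f}"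
    have "r \<in> R - \<F>" using that parts by auto
    then show "W < sum w ?S" using rej[of r] fins by simp
    show "feasible ?S w h W p'" using p'(1) by (rule feasible_mono) (use FR QR that in auto)
    show "snd (p' s) + h s \<le> H" if "s \<in> ?S" for s using top FR QR that \<open>r \<in> R - \<F>\<close> by auto
  qed (use fins R FR QR that in auto)
  define hW where "hW = sum h \<W>"
  have hW: "hW \<le> H" unfolding hW_def
    by (rule feasible_wide_heights_le[OF fins(3) _ feasible_mono[OF p'(1) WR] H0])
      (use R parts top WR in auto)
  have "(\<Sum>r\<in>\<F> \<union> \<Q>. w r * h r) + W / 2 * hW \<le> (\<Sum>r\<in>\<F> \<union> \<Q>. w r * h r) + (\<Sum>r\<in>\<W>. w r * h r)"
    unfolding hW_def sum_distrib_left using R(3) parts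
    by (intro add_left_mono sum_mono mult_right_mono) (auto intro: less_imp_le)
  also have "\<dots> = (\<Sum>r\<in>R. w r * h r)"
    unfolding R_eq using fins apart by (intro sum.union_disjoint[symmetric]) auto
  also have "\<dots> \<le> W * H"
    using feasible_area_le[OF R(2,3) _ p'(1) H0 top] R(1) by simp
  finally have area: "(\<Sum>r\<in>\<F> \<union> \<Q>. w r * h r) + W / 2 * hW \<le> W * H" .

  \<comment> \<open>The level below which \<open>\<F>\<close> and \<open>\<Q>\<close> must end, so
    that room for all of \<open>\<W>\<close> stacked on top remains.\<close>
  define T where "T = 13 / 6 * H - hW"
  have T0: "0 \<le> T" using hW H0 by (simp add: T_def)
  have topF: "snd (p r) + h r \<le> T" if "r \<in> \<F>" for r
  proof -
    have "h r \<le> H" using hH FR that by auto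
    then show ?thesis using floor[OF that] hW H0 by (simp add: T_def)
  qed
  have topQ: "snd (p r) + h r \<le> T" if r: "r \<in> \<Q>" for r
  proof -
    obtain n where n: "n < length qs" "r = qs ! n" using r sets(2) by (metis in_set_conv_nth)
    let ?k = "Max (h ` \<Q>)"
    have k: "?k \<in> h ` \<Q>" "\<And>s. s \<in> \<Q> \<Longrightarrow> h s \<le> ?k"
      using Max_in[of "h ` \<Q>"] Max_ge[of "h ` \<Q>"] r fins(2) by blast+
    have "2 * ?k \<le> H" using k(1) heavy by auto
    then have "W * ?k / 3 \<le> W * (H / 6)" using R(1) by simp
    moreover have "W * (snd (p r) + h r) \<le> 2 * (\<Sum>r\<in>\<F> \<union> \<Q>. w r * h r) + W * ?k / 3"
      using narrow_top_le[OF n(1), of ?k] k sets n(2) by simp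
    \<comment> \<open>The ratio arises here as 2 + 1/6: twice the area bound gives
      \<open>2 * H - hW\<close>, and the bound on \<open>?k\<close> adds
      \<open>H / 6\<close>.\<close>
    ultimately have "W * (snd (p r) + h r) \<le> W * T"
      using area by (simp add: T_def algebra_simps)
    then show ?thesis using R(1) by simp
  qed
  \<comment> \<open>Each member of \<open>\<W>\<close> could be put at the left wall on top of
    everything before it, so it raises the packing by at most its height.\<close>
  have "\<forall>s\<in>set (fs @ qs @ take j ws). snd (p s) + h s \<le> T + sum h (set (take j ws))"
    if "j \<le> length ws" for j
    using that
  proof (induction j)
    case 0
    show ?case using topF topQ sets by auto
  next
    case (Suc j)
    let ?r = "ws ! j" and ?i = "length fs + length qs + j"
    have nth: "rs ! ?i = ?r" "take ?i rs = fs @ qs @ take j ws"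
      using Suc.prems by (auto simp: rs nth_append)
    have i: "1 \<le> ?i" "?i < length rs" using Suc.prems fs0 by (auto simp: rs)
    have r: "?r \<notin> set (take j ws)" "?r \<in> R"
      using Suc.prems sets(3,6) WR nth_mem[of j ws] by (auto simp: in_set_conv_nth nth_eq_iff_index_eq)
    have "0 \<le> sum h (set (take j ws))"
      using R(3) WR sets set_take_subset[of j ws] by (intro sum_nonneg) (auto intro: less_imp_le)
    then have "snd (p (rs ! ?i)) \<le> T + sum h (set (take j ws))"
      using Suc T0 by (intro bottom_left_le_top[OF bl rs_dims(2) dist i]) (auto simp: nth)
    moreover have "sum h (set (take (Suc j) ws)) = sum h (set (take j ws)) + h ?r"
      using r Suc.prems by (simp add: take_Suc_conv_app_nth)
    moreover have "0 < h ?r" using R(3) r by auto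
    ultimately show ?case
      using Suc nth(1) by (force simp: take_Suc_conv_app_nth)
  qed
  from this[of "length ws"] have "snd (p r) + h r \<le> 13 / 6 * H" if "r \<in> R" for r
    using that set_rs sets by (auto simp: rs T_def hW_def)
  then show ?thesis
    using False R(2) unfolding packing_height_def H_def
    by (simp only: if_False) (subst Max_le_iff, auto)
qed

end
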